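(* Let $\alpha>-1$, let $n$ be a positive integer, let $\psi$ be an analytic function on $\mathbb{D}$ that is not identically $0$, and let $\varphi$ be a nonconstant analytic self-map of $\mathbb{D}$. Suppose that the operator $D_{\psi,\varphi,n}$ is bounded on $A_\alpha^2$. Then $D_{\psi,\varphi,n}$ is $J$-symmetric on $A_\alpha^2$ if and only if $$\psi(z)=\frac{a}{t\,n!}K_{\overline{c}}^{(n)}(z)=\frac{a z^n}{n!\,(1-cz)^{n+\alpha+2}}\qquad\text{and}\qquad \varphi(z)=c+\frac{bz}{1-cz}\qquad (z\in\mathbb{D}),$$ where $a=\psi^{(n)}(0)$ and $b=\varphi'(0)$ are both nonzero complex numbers and $c=\varphi(0)$ belongs to $\mathbb{D}$.
   Context: $\mathbb{D}$ is the open unit disk in $\mathbb{C}$. For $\alpha>-1$, the weighted Bergman space $A_\alpha^2$ is the Hilbert space of analytic functions $f(z)=\sum_{j\ge0}a_jz^j$ on $\mathbb{D}$ with $\|f\|^2=\sum_{j\ge0}|a_j|^2\beta(j)^2<\infty$, where $\beta(j)^2=\frac{j!\,\Gamma(\alpha+2)}{\Gamma(j+\alpha+2)}$, with inner product $\langle\sum a_jz^j,\sum b_jz^j\rangle=\sum a_j\overline{b_j}\beta(j)^2$. For $w\in\mathbb{D}$ and an integer $m\ge0$, $K_w^{(m)}\in A_\alpha^2$ is the function with $\langle f,K_w^{(m)}\rangle=f^{(m)}(w)$ for all $f\in A_\alpha^2$; explicitly $K_w^{(m)}(z)=\frac{(\alpha+2)\cdots(\alpha+m+1)z^m}{(1-\overline{w}z)^{m+\alpha+2}}$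 (for $m=0$: $K_w(z)=(1-\overline{w}z)^{-(\alpha+2)}$). Non-integer powers use the principal branch. Put $t=(\alpha+2)(\alpha+3)\cdots(\alpha+n+1)$. The weighted composition--differentiation operator of order $n$ is $D_{\psi,\varphi,n}f=\psi\cdot(f^{(n)}\circ\varphi)$. A conjugation on a complex Hilbert space is an antilinear isometric involution $C$; a bounded operator $T$ is $C$-symmetric if $CT^*C=T$. $J$ is the conjugation $(Jf)(z)=\overline{f(\overline{z})}$. *)

theory Defs
  imports "HOL-Complex_Analysis.Complex_Analysis"
begin

abbreviation unit_disc :: "complex set" where
  "unit_disc \<equiv> ball 0 1"

definition taylor_coeff :: "(complex \<Rightarrow> complex) \<Rightarrow> nat \<Rightarrow> complex" where
  "taylor_coeff f j = (deriv ^^ j) f 0 / fact j"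

text \<open>This is \<open>\<beta>(j)\<^sup>2\<close>, the squared norm of \<open>z\<^sup>j\<close>.\<close>

definition bergman_weight :: "real \<Rightarrow> nat \<Rightarrow> real" where
  "bergman_weight \<alpha> j = fact j * Gamma (\<alpha> + 2) / Gamma (real j + \<alpha> + 2)"

text \<open>Functions on the disc are represented by total functions that vanish outside it, so that
  equality of elements of the space is equality in HOL.\<close>

definition bergman_space :: "real \<Rightarrow> (complex \<Rightarrow> complex) set" where
  "bergman_space \<alpha> = {f. f holomorphic_on unit_disc \<and> (\<forall>z. z \<notin> unit_disc \<longrightarrow> f z = 0) \<and>
     summable (\<lambda>j. (cmod (taylor_coeff f j))\<^sup>2 * bergman_weight \<alpha> j)}"

definition bergman_inner :: "real \<Rightarrow> (complex \<Rightarrow> complex) \<Rightarrow> (complex \<Rightarrow> complex) \<Rightarrow> complex" where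
  "bergman_inner \<alpha> f g =
     (\<Sum>j. taylor_coeff f j * cnj (taylor_coeff g j) * of_real (bergman_weight \<alpha> j))"

definition bergman_norm :: "real \<Rightarrow> (complex \<Rightarrow> complex) \<Rightarrow> real" where
  "bergman_norm \<alpha> f = sqrt (\<Sum>j. (cmod (taylor_coeff f j))\<^sup>2 * bergman_weight \<alpha> j)"

definition bergman_kernel :: "real \<Rightarrow> nat \<Rightarrow> complex \<Rightarrow> complex \<Rightarrow> complex" where
  "bergman_kernel \<alpha> m w =
     (THE k. k \<in> bergman_space \<alpha> \<and>
        (\<forall>f\<in>bergman_space \<alpha>. bergman_inner \<alpha> f k = (deriv ^^ m) f w))"

definition bounded_operator ::
    "real \<Rightarrow> ((complex \<Rightarrow> complex) \<Rightarrow> complex \<Rightarrow> complex) \<Rightarrow> bool" where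
  "bounded_operator \<alpha> T \<longleftrightarrow>
     T ` bergman_space \<alpha> \<subseteq> bergman_space \<alpha> \<and>
     (\<forall>f\<in>bergman_space \<alpha>. \<forall>g\<in>bergman_space \<alpha>. \<forall>u v.
        T (\<lambda>z. u * f z + v * g z) = (\<lambda>z. u * T f z + v * T g z)) \<and>
     (\<exists>M. \<forall>f\<in>bergman_space \<alpha>. bergman_norm \<alpha> (T f) \<le> M * bergman_norm \<alpha> f)"

definition bergman_adjoint ::
    "real \<Rightarrow> ((complex \<Rightarrow> complex) \<Rightarrow> complex \<Rightarrow> complex) \<Rightarrow> (complex \<Rightarrow> complex) \<Rightarrow> complex \<Rightarrow> complex" where
  "bergman_adjoint \<alpha> T g =
     (THE h. h \<in> bergman_space \<alpha> \<and>
        (\<forall>f\<in>bergman_space \<alpha>. bergman_inner \<alpha> (T f) g = bergman_inner \<alpha> f h))"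

definition conjugation ::
    "real \<Rightarrow> ((complex \<Rightarrow> complex) \<Rightarrow> complex \<Rightarrow> complex) \<Rightarrow> bool" where
  "conjugation \<alpha> C \<longleftrightarrow>
     C ` bergman_space \<alpha> \<subseteq> bergman_space \<alpha> \<and>
     (\<forall>f\<in>bergman_space \<alpha>. \<forall>g\<in>bergman_space \<alpha>. \<forall>u v.
        C (\<lambda>z. u * f z + v * g z) = (\<lambda>z. cnj u * C f z + cnj v * C g z)) \<and>
     (\<forall>f\<in>bergman_space \<alpha>. bergman_norm \<alpha> (C f) = bergman_norm \<alpha> f) \<and>
     (\<forall>f\<in>bergman_space \<alpha>. C (C f) = f)"

definition C_symmetric ::
    "real \<Rightarrow> ((complex \<Rightarrow> complex) \<Rightarrow> complex \<Rightarrow> complex) \<Rightarrow>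
     ((complex \<Rightarrow> complex) \<Rightarrow> complex \<Rightarrow> complex) \<Rightarrow> bool" where
  "C_symmetric \<alpha> C T \<longleftrightarrow>
     conjugation \<alpha> C \<and> bounded_operator \<alpha> T \<and>
     (\<forall>f\<in>bergman_space \<alpha>. C (bergman_adjoint \<alpha> T (C f)) = T f)"

definition J_conj :: "(complex \<Rightarrow> complex) \<Rightarrow> complex \<Rightarrow> complex" where
  "J_conj f = (\<lambda>z. cnj (f (cnj z)))"

definition comp_diff_op ::
    "(complex \<Rightarrow> complex) \<Rightarrow> (complex \<Rightarrow> complex) \<Rightarrow> nat \<Rightarrow> (complex \<Rightarrow> complex) \<Rightarrow> complex \<Rightarrow> complex" where
  "comp_diff_op \<psi> \<phi> n f =
     (\<lambda>z. if z \<in> unit_disc then \<psi> z * (deriv ^^ n) f (\<phi> z) else 0)"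

lemma deriv_J_conj:
  assumes "f holomorphic_on unit_disc" "z \<in> unit_disc"
  shows "deriv (J_conj f) z = J_conj (deriv f) z"
proof -
  have "cnj z \<in> unit_disc" using assms(2) by simp
  then have "(f has_field_derivative deriv f (cnj z)) (at (cnj z))"
    using assms(1) holomorphic_derivI open_ball by blast
  then have "(cnj \<circ> f \<circ> cnj has_field_derivative cnj (deriv f (cnj z))) (at z)"
    using has_field_derivative_cnj_cnj by fastforce
  then show ?thesis
    by (simp add: J_conj_def o_def DERIV_imp_deriv)
qed

lemma holomorphic_J_conj:
  assumes "f holomorphic_on unit_disc"
  shows "J_conj f holomorphic_on unit_disc"
proof -
  have "cnj ` unit_disc = unit_disc"
    by (auto simp: image_iff intro!: bexI[of _ "cnj _"])
  then have "cnj \<circ> f \<circ> cnj holomorphic_on unit_disc"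
    using assms holomorphic_on_compose_cnj_cnj[of f unit_disc] by simp
  then show ?thesis by (simp add: J_conj_def o_def)
qed

lemma higher_deriv_J_conj:
  assumes "f holomorphic_on unit_disc" "z \<in> unit_disc"
  shows "(deriv ^^ k) (J_conj f) z = J_conj ((deriv ^^ k) f) z"
  using assms(2)
proof (induction k arbitrary: z)
  case (Suc k)
  have "eventually (\<lambda>x. x \<in> unit_disc) (nhds z)"
    using Suc.prems by (intro eventually_nhds_in_open) auto
  then have "eventually (\<lambda>x. (deriv ^^ k) (J_conj f) x = J_conj ((deriv ^^ k) f) x) (nhds z)"
    by eventually_elim (rule Suc.IH)
  then have "(deriv ^^ Suc k) (J_conj f) z = deriv (J_conj ((deriv ^^ k) f)) z"
    by (simp add: deriv_cong_ev)
  also have "\<dots> = J_conj ((deriv ^^ Suc k) f) z"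
    using deriv_J_conj[OF holomorphic_higher_deriv[OF assms(1)] Suc.prems] by simp
  finally show ?case .
qed simp

lemma conjugation_J_conj: "conjugation \<alpha> J_conj"
proof -
  have coeff: "cmod (taylor_coeff (J_conj f) j) = cmod (taylor_coeff f j)"
    if "f \<in> bergman_space \<alpha>" for f j
    using that higher_deriv_J_conj[of f 0 j]
    by (simp add: taylor_coeff_def bergman_space_def norm_divide J_conj_def[of "(deriv ^^ j) f"])
  have "J_conj f \<in> bergman_space \<alpha>" if f: "f \<in> bergman_space \<alpha>" for f
    using f holomorphic_J_conj[of f] coeff[OF f]
    by (simp add: bergman_space_def) (simp add: J_conj_def)
  then show ?thesis
    using coeff by (auto simp: conjugation_def bergman_norm_def J_conj_def[abs_def])
qed

end

theory Submission
  imports Defs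
begin

text \<open>Write \<open>T\<close> for the operator and \<open>p = n + \<alpha> + 2\<close>. Evaluating \<open>J T\<^sup>* J = T\<close> on the kernels
  \<open>K\<^sub>w\<close> turns \<open>J\<close>-symmetry into the identity
  \<open>\<psi>(z) w\<^sup>n (1 - \<phi>(z) w)\<^bsup>-p\<^esup> = \<psi>(w) z\<^sup>n (1 - \<phi>(w) z)\<^bsup>-p\<^esup>\<close>
  on the bidisc. It forces \<open>\<psi>(z) = z\<^sup>n g(z)\<close> with \<open>g\<close> zero-free; setting \<open>w = 0\<close> after dividing by
  \<open>(z w)\<^sup>n\<close> gives \<open>\<psi>\<close>, and differentiating in \<open>w\<close> at \<open>0\<close> gives \<open>\<phi>\<close>. Conversely, the stated forms
  make \<open>(1 - c z) (1 - \<phi>(z) w)\<close> symmetric in \<open>z\<close> and \<open>w\<close>, hence the identity holds, and it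
  extends from kernels to the whole space by continuity.\<close>

section \<open>Taylor coefficients of functions on the disc\<close>

lemma taylor_coeff_sums:
  assumes "f holomorphic_on unit_disc" "z \<in> unit_disc"
  shows "(\<lambda>j. taylor_coeff f j * z ^ j) sums f z"
  using holomorphic_power_series[OF assms] by (simp add: taylor_coeff_def)

lemma holomorphic_on_disc_powser:
  assumes "\<And>z. z \<in> unit_disc \<Longrightarrow> (\<lambda>j. c j * z ^ j) sums f z"
  shows "f holomorphic_on unit_disc"
  using power_series_holomorphic[of 0 1 c f] assms by simp

text \<open>Convergence on the disc gives the formal series a positive radius of convergence, so it
  is the expansion of \<open>f\<close> at 0. Coefficients can thus be found by exhibiting a series
  instead of differentiating.\<close>

lemma taylor_coeff_unique:
  assumes "\<And>z. z \<in> unit_disc \<Longrightarrow> (\<lambda>j. c j * z ^ j) sums f z"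
  shows "taylor_coeff f j = c j"
proof -
  define F where "F = Abs_fps c"
  have rad: "fps_conv_radius F > 0"
  proof -
    \<comment> \<open>Any nonzero point of the disc would do; 1/2 bounds the radius of convergence
      from below.\<close>
    have "summable (\<lambda>j. c j * (1/2) ^ j)"
      using assms[of "1/2"] by (auto simp: sums_iff)
    from conv_radius_geI[OF this] show ?thesis
      by (simp add: fps_conv_radius_def F_def)
        (metis less_le_trans ereal_less(2) half_gt_zero zero_less_one)
  qed
  have "eventually (\<lambda>z. z \<in> unit_disc) (nhds (0::complex))"
    by (intro eventually_nhds_in_open) auto
  then have "eventually (\<lambda>z. eval_fps F z = f z) (nhds 0)"
    by eventually_elim (use assms in \<open>auto simp: eval_fps_def F_def sums_iff\<close>)
  with rad have "f has_fps_expansion F"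
    by (simp add: has_fps_expansion_def)
  then show ?thesis
    using fps_nth_fps_expansion[of f F j] by (simp add: taylor_coeff_def F_def)
qed

lemma taylor_coeff_power_mult:
  assumes "g holomorphic_on unit_disc" "\<And>z. z \<in> unit_disc \<Longrightarrow> f z = z ^ m * g z"
  shows "taylor_coeff f j = (if j < m then 0 else taylor_coeff g (j - m))"
proof (rule taylor_coeff_unique)
  fix z :: complex assume z: "z \<in> unit_disc"
  let ?c = "\<lambda>j. (if j < m then 0 else taylor_coeff g (j - m)) * z ^ j"
  have "(\<lambda>i. z ^ m * (taylor_coeff g i * z ^ i)) sums f z"
    using sums_mult[OF taylor_coeff_sums[OF assms(1) z], of "z ^ m"] assms(2)[OF z] by simp
  then have "(\<lambda>i. ?c (i + m)) sums f z"
    by (simp add: power_add mult_ac)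
  then show "?c sums f z"
    by (subst (asm) sums_zero_iff_shift) auto
qed

lemma taylor_coeff_linear:
  assumes "f holomorphic_on unit_disc" "g holomorphic_on unit_disc"
  shows "taylor_coeff (\<lambda>z. u * f z + v * g z) j = u * taylor_coeff f j + v * taylor_coeff g j"
proof (rule taylor_coeff_unique)
  fix z :: complex assume z: "z \<in> unit_disc"
  show "(\<lambda>j. (u * taylor_coeff f j + v * taylor_coeff g j) * z ^ j) sums (u * f z + v * g z)"
    using sums_add[OF sums_mult[OF taylor_coeff_sums[OF assms(1) z], of u]
        sums_mult[OF taylor_coeff_sums[OF assms(2) z], of v]]
    by (simp add: algebra_simps)
qed

section \<open>Elements of the Bergman space, the conjugation \<open>J_conj\<close> and
  monomials\<close>

lemma bergman_spaceD:
  assumes "f \<in> bergman_space \<alpha>"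
  shows "f holomorphic_on unit_disc" "z \<notin> unit_disc \<Longrightarrow> f z = 0"
    "summable (\<lambda>j. (cmod (taylor_coeff f j))\<^sup>2 * bergman_weight \<alpha> j)"
  using assms by (auto simp: bergman_space_def)

lemma J_conj_J_conj [simp]: "J_conj (J_conj f) = f"
  by (simp add: J_conj_def)

lemma J_conj_in_bergman_space: "f \<in> bergman_space \<alpha> \<Longrightarrow> J_conj f \<in> bergman_space \<alpha>"
  using conjugation_J_conj[of \<alpha>] by (auto simp: conjugation_def)

lemma bergman_norm_J_conj: "f \<in> bergman_space \<alpha> \<Longrightarrow> bergman_norm \<alpha> (J_conj f) = bergman_norm \<alpha> f"
  using conjugation_J_conj[of \<alpha>] by (auto simp: conjugation_def)

lemma J_conj_linear:
  "J_conj (\<lambda>z. u * f z + v * g z) = (\<lambda>z. cnj u * J_conj f z + cnj v * J_conj g z)"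
  by (simp add: J_conj_def)

lemma J_conj_scale: "J_conj (\<lambda>z. u * f z) = (\<lambda>z. cnj u * J_conj f z)"
  by (simp add: J_conj_def)

text \<open>The cut-off makes the monomial an element of \<open>bergman_space\<close>, whose
  functions vanish outside the disc.\<close>

definition bergman_monom :: "nat \<Rightarrow> complex \<Rightarrow> complex" where
  "bergman_monom k = (\<lambda>z. if z \<in> unit_disc then z ^ k else 0)"

lemma taylor_coeff_monom: "taylor_coeff (bergman_monom k) j = (if j = k then 1 else 0)"
proof (rule taylor_coeff_unique)
  fix z :: complex assume "z \<in> unit_disc"
  moreover have "(\<lambda>j. if j = k then z ^ j else 0) sums z ^ k"
    by (rule sums_single)
  moreover have "(\<lambda>j. (if j = k then 1 else 0) * z ^ j) = (\<lambda>j. if j = k then z ^ j else 0)"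
    by auto
  ultimately show "(\<lambda>j. (if j = k then 1 else 0) * z ^ j) sums bergman_monom k z"
    by (simp add: bergman_monom_def)
qed

lemma bergman_monom_in_space: "bergman_monom k \<in> bergman_space \<alpha>"
proof -
  have "bergman_monom k holomorphic_on unit_disc"
    by (rule holomorphic_transform[of "\<lambda>z. z ^ k"])
      (auto simp: bergman_monom_def intro!: holomorphic_intros)
  moreover have "summable (\<lambda>j. (cmod (taylor_coeff (bergman_monom k) j))\<^sup>2 * bergman_weight \<alpha> j)"
    by (rule summable_finite[of "{k}"]) (auto simp: taylor_coeff_monom)
  ultimately show ?thesis
    by (simp add: bergman_space_def) (simp add: bergman_monom_def)
qed

lemma bergman_space_eqI:
  assumes "f \<in> bergman_space \<alpha>" "g \<in> bergman_space \<alpha>"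
    and "\<And>j. taylor_coeff f j = taylor_coeff g j"
  shows "f = g"
proof
  fix z
  show "f z = g z"
  proof (cases "z \<in> unit_disc")
    case True
    then show ?thesis
      using taylor_coeff_sums[of f z] taylor_coeff_sums[of g z] assms bergman_spaceD(1)
      by (auto intro: sums_unique2)
  next
    case False
    then show ?thesis using assms bergman_spaceD(2) by metis
  qed
qed

section \<open>Principal powers of 1 - u z\<close>

text \<open>Since |u z| < 1, the number 1 - u z stays away from the branch cut; this justifies every
  later manipulation of complex powers.\<close>

lemma one_minus_mult_in_right_half_plane:
  assumes "u \<in> unit_disc" "z \<in> unit_disc"
  shows "Re (1 - u * z) > 0" "1 - u * z \<notin> \<real>\<^sub>\<le>\<^sub>0" "1 - u * z \<noteq> 0"
proof -
  have "cmod (u * z) < 1"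
    using assms norm_mult_less[of u 1 z 1] by simp
  then show "Re (1 - u * z) > 0"
    using complex_Re_le_cmod[of "u * z"] by (simp del: times_complex.sel)
  then show "1 - u * z \<notin> \<real>\<^sub>\<le>\<^sub>0"
    by (auto simp: complex_nonpos_Reals_iff)
  then show "1 - u * z \<noteq> 0" by auto
qed

text \<open>Newton's binomial series at -x with exponent -q: the sign in the binomial coefficient
  cancels the sign of (-x)^i.\<close>

lemma one_minus_powr_sums:
  assumes "cmod x < 1"
  shows "(\<lambda>i. pochhammer q i / fact i * x ^ i) sums (1 - x) powr (- q)"
proof -
  have "((- q) gchoose i) * (- x) ^ i = pochhammer q i / fact i * x ^ i" for i
  proof -
    have "((- q) gchoose i) * (- x) ^ i = ((- 1) ^ i * (- 1) ^ i) * (pochhammer q i / fact i * x ^ i)"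
      by (subst power_minus) (simp add: gbinomial_pochhammer)
    then show ?thesis by (simp flip: power_mult_distrib)
  qed
  then show ?thesis
    using gen_binomial_complex[of "- x" "- q"] assms by simp
qed

section \<open>Weights, inner product and bounded functionals\<close>

context
  fixes \<alpha> :: real
  assumes \<alpha>: "\<alpha> > -1"
begin

lemma pochhammer_alpha_pos: "pochhammer (\<alpha> + 2) j > 0"
  using \<alpha> by (intro pochhammer_pos) auto

lemma pochhammer_alpha_nonzero: "pochhammer (of_real (\<alpha> + 2) :: complex) j \<noteq> 0"
  using pochhammer_alpha_pos[of j] by (simp add: pochhammer_of_real del: of_real_add)

text \<open>The quotient of Gamma values is a rising factorial. In this form the weight cancels
  against the coefficients of the kernels.\<close>

lemma bergman_weight_pochhammer: "bergman_weight \<alpha> j = fact j / pochhammer (\<alpha> + 2) j"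
proof -
  have "\<alpha> + 2 \<notin> \<int>\<^sub>\<le>\<^sub>0" using \<alpha> by (auto elim!: nonpos_Ints_cases)
  moreover have "Gamma (\<alpha> + 2) > 0" using \<alpha> by (intro Gamma_real_pos) auto
  ultimately show ?thesis
    by (simp add: bergman_weight_def pochhammer_Gamma add_ac)
qed

lemma bergman_weight_pos: "bergman_weight \<alpha> j > 0"
  using pochhammer_alpha_pos by (simp add: bergman_weight_pochhammer)

text \<open>The inequality |x + y|^2 \<le> 2 |x|^2 + 2 |y|^2, applied to each coefficient, dominates
  the series of the combination.\<close>

lemma bergman_space_linear:
  assumes "f \<in> bergman_space \<alpha>" "g \<in> bergman_space \<alpha>"
  shows "(\<lambda>z. u * f z + v * g z) \<in> bergman_space \<alpha>"
proof -
  note f = bergman_spaceD[OF assms(1)] and g = bergman_spaceD[OF assms(2)]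
  let ?f = "taylor_coeff f" and ?g = "taylor_coeff g"
  have bound: "norm ((cmod (u * ?f j + v * ?g j))\<^sup>2 * bergman_weight \<alpha> j)
      \<le> 2 * (cmod u)\<^sup>2 * ((cmod (?f j))\<^sup>2 * bergman_weight \<alpha> j)
        + 2 * (cmod v)\<^sup>2 * ((cmod (?g j))\<^sup>2 * bergman_weight \<alpha> j)" for j
  proof -
    have "(cmod (u * ?f j + v * ?g j))\<^sup>2 \<le> (cmod (u * ?f j) + cmod (v * ?g j))\<^sup>2"
      by (intro power_mono norm_triangle_ineq) auto
    also have "\<dots> \<le> 2 * (cmod (u * ?f j))\<^sup>2 + 2 * (cmod (v * ?g j))\<^sup>2"
      using sum_squares_bound[of "cmod (u * ?f j)" "cmod (v * ?g j)"]
      by (simp add: power2_sum)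
    finally show ?thesis
      using bergman_weight_pos[of j] mult_right_mono[of _ _ "bergman_weight \<alpha> j"]
      by (fastforce simp: norm_mult power_mult_distrib algebra_simps)
  qed
  have "summable (\<lambda>j. (cmod (u * ?f j + v * ?g j))\<^sup>2 * bergman_weight \<alpha> j)"
    by (rule summable_comparison_test'[OF summable_add[OF summable_mult[OF f(3)] summable_mult[OF g(3)]] bound])
  then show ?thesis
    using f g by (auto simp: bergman_space_def taylor_coeff_linear intro!: holomorphic_intros)
qed

lemma bergman_space_scale:
  assumes "f \<in> bergman_space \<alpha>"
  shows "(\<lambda>z. u * f z) \<in> bergman_space \<alpha>"
  using bergman_space_linear[OF assms assms, of u 0] by simp

lemma bergman_norm_sum_le:
  assumes "f \<in> bergman_space \<alpha>"
  shows "L2_set (\<lambda>j. cmod (taylor_coeff f j) * sqrt (bergman_weight \<alpha> j)) {..<N} \<le> bergman_norm \<alpha> f"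
  unfolding L2_set_def bergman_norm_def
  using sum_le_suminf[OF bergman_spaceD(3)[OF assms], of "{..<N}"] bergman_weight_pos
  by (simp add: power_mult_distrib less_imp_le)

lemma bergman_norm_nonneg: "f \<in> bergman_space \<alpha> \<Longrightarrow> bergman_norm \<alpha> f \<ge> 0"
  using bergman_norm_sum_le[of f 0] by simp

text \<open>The finite Cauchy-Schwarz inequality bounds all partial sums of absolute values by the
  product of the norms. This one bound gives both absolute convergence and the inequality for the
  full series.\<close>

lemma bergman_inner_aux:
  assumes "f \<in> bergman_space \<alpha>" "g \<in> bergman_space \<alpha>"
  shows "summable (\<lambda>j. taylor_coeff f j * cnj (taylor_coeff g j) * of_real (bergman_weight \<alpha> j))"
    and "cmod (bergman_inner \<alpha> f g) \<le> bergman_norm \<alpha> f * bergman_norm \<alpha> g"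
proof -
  let ?w = "bergman_weight \<alpha>"
  let ?x = "\<lambda>j. taylor_coeff f j * cnj (taylor_coeff g j) * of_real (?w j)"
  have part: "(\<Sum>j<N. norm (?x j)) \<le> bergman_norm \<alpha> f * bergman_norm \<alpha> g" for N
  proof -
    have "(\<Sum>j<N. norm (?x j)) = (\<Sum>j<N. \<bar>cmod (taylor_coeff f j) * sqrt (?w j)\<bar> * \<bar>cmod (taylor_coeff g j) * sqrt (?w j)\<bar>)"
      using bergman_weight_pos
      by (intro sum.cong refl) (simp add: norm_mult abs_mult less_imp_le mult_ac)
    also have "\<dots> \<le> L2_set (\<lambda>j. cmod (taylor_coeff f j) * sqrt (?w j)) {..<N}
        * L2_set (\<lambda>j. cmod (taylor_coeff g j) * sqrt (?w j)) {..<N}"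
      by (rule L2_set_mult_ineq)
    also have "\<dots> \<le> bergman_norm \<alpha> f * bergman_norm \<alpha> g"
      by (intro mult_mono bergman_norm_sum_le assms bergman_norm_nonneg L2_set_nonneg)
    finally show ?thesis .
  qed
  have sn: "summable (\<lambda>j. norm (?x j))"
    by (rule summableI_nonneg_bounded[OF _ part]) auto
  then show "summable ?x" by (rule summable_norm_cancel)
  have "cmod (bergman_inner \<alpha> f g) \<le> (\<Sum>j. norm (?x j))"
    unfolding bergman_inner_def by (rule summable_norm[OF sn])
  also have "\<dots> \<le> bergman_norm \<alpha> f * bergman_norm \<alpha> g"
    by (rule suminf_le_const[OF sn part])
  finally show "cmod (bergman_inner \<alpha> f g) \<le> bergman_norm \<alpha> f * bergman_norm \<alpha> g" .
qed

lemmas bergman_inner_summable = bergman_inner_aux(1)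
  and bergman_Cauchy_Schwarz = bergman_inner_aux(2)

lemma bergman_inner_cnj:
  assumes "f \<in> bergman_space \<alpha>" "g \<in> bergman_space \<alpha>"
  shows "bergman_inner \<alpha> g f = cnj (bergman_inner \<alpha> f g)"
  using sums_cnj[THEN iffD2, OF summable_sums[OF bergman_inner_summable[OF assms]]]
  by (simp add: bergman_inner_def sums_iff mult_ac)

lemma bergman_inner_linear_right:
  assumes "f \<in> bergman_space \<alpha>" "g \<in> bergman_space \<alpha>" "h \<in> bergman_space \<alpha>"
  shows "bergman_inner \<alpha> h (\<lambda>z. u * f z + v * g z)
    = cnj u * bergman_inner \<alpha> h f + cnj v * bergman_inner \<alpha> h g"
proof -
  note sf = summable_sums[OF bergman_inner_summable[OF assms(3,1)]]
    and sg = summable_sums[OF bergman_inner_summable[OF assms(3,2)]]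
  show ?thesis
    using sums_add[OF sums_mult[OF sf, of "cnj u"] sums_mult[OF sg, of "cnj v"]]
    by (simp add: bergman_inner_def sums_iff taylor_coeff_linear bergman_spaceD(1)[OF assms(1)]
        bergman_spaceD(1)[OF assms(2)] algebra_simps)
qed

lemma bergman_inner_scale_right:
  assumes "f \<in> bergman_space \<alpha>" "h \<in> bergman_space \<alpha>"
  shows "bergman_inner \<alpha> h (\<lambda>z. u * f z) = cnj u * bergman_inner \<alpha> h f"
  using bergman_inner_linear_right[OF assms(1) assms(1) assms(2), of u 0] by simp

lemma bergman_inner_monom:
  "bergman_inner \<alpha> (bergman_monom k) g = cnj (taylor_coeff g k) * of_real (bergman_weight \<alpha> k)"
proof -
  have "(\<lambda>j. taylor_coeff (bergman_monom k) j * cnj (taylor_coeff g j) * of_real (bergman_weight \<alpha> j))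
    = (\<lambda>j. if j = k then cnj (taylor_coeff g j) * of_real (bergman_weight \<alpha> j) else 0)"
    by (auto simp: taylor_coeff_monom)
  then show ?thesis
    using sums_single[of k "\<lambda>j. cnj (taylor_coeff g j) * of_real (bergman_weight \<alpha> j)"]
    by (simp add: bergman_inner_def sums_iff)
qed

text \<open>Testing against monomials isolates single coefficients, up to a positive weight.\<close>

lemma bergman_inner_ext:
  assumes "g \<in> bergman_space \<alpha>" "h \<in> bergman_space \<alpha>"
    and "\<And>f. f \<in> bergman_space \<alpha> \<Longrightarrow> bergman_inner \<alpha> f g = bergman_inner \<alpha> f h"
  shows "g = h"
proof (rule bergman_space_eqI[OF assms(1,2)])
  fix j
  have "cnj (taylor_coeff g j) = cnj (taylor_coeff h j)"
    using assms(3)[OF bergman_monom_in_space[of j]] bergman_weight_pos[of j]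
    by (simp add: bergman_inner_monom del: complex_cnj_cancel_iff)
  then show "taylor_coeff g j = taylor_coeff h j" by simp
qed

text \<open>By \<open>bergman_inner_ext\<close> at most one function satisfies the adjoint relation,
  so exhibiting one resolves the definite description.\<close>

lemma bergman_adjoint_eqI:
  assumes "h \<in> bergman_space \<alpha>"
    and "\<And>f. f \<in> bergman_space \<alpha> \<Longrightarrow> bergman_inner \<alpha> (T f) g = bergman_inner \<alpha> f h"
  shows "bergman_adjoint \<alpha> T g = h"
  unfolding bergman_adjoint_def
proof (rule the_equality)
  show "h \<in> bergman_space \<alpha> \<and>
      (\<forall>f\<in>bergman_space \<alpha>. bergman_inner \<alpha> (T f) g = bergman_inner \<alpha> f h)"
    using assms by blast
next
  fix h' assume h': "h' \<in> bergman_space \<alpha> \<and>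
      (\<forall>f\<in>bergman_space \<alpha>. bergman_inner \<alpha> (T f) g = bergman_inner \<alpha> f h')"
  show "h' = h"
    by (rule bergman_inner_ext) (use h' assms in \<open>force+\<close>)
qed

text \<open>Removing the first N Taylor terms from \<open>h\<close> leaves a remainder whose squared
  norm is a tail of a convergent series; boundedness of \<open>L\<close> then makes its value on the
  remainder tend to 0.\<close>

lemma bounded_functional_sums:
  fixes L :: "(complex \<Rightarrow> complex) \<Rightarrow> complex"
  assumes lin: "\<And>f g u v. f \<in> bergman_space \<alpha> \<Longrightarrow> g \<in> bergman_space \<alpha> \<Longrightarrow>
      L (\<lambda>z. u * f z + v * g z) = u * L f + v * L g"
    and bdd: "\<And>f. f \<in> bergman_space \<alpha> \<Longrightarrow> cmod (L f) \<le> M * bergman_norm \<alpha> f"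
    and h: "h \<in> bergman_space \<alpha>"
  shows "(\<lambda>j. taylor_coeff h j * L (bergman_monom j)) sums L h"
proof -
  let ?x = "\<lambda>j. (cmod (taylor_coeff h j))\<^sup>2 * bergman_weight \<alpha> j"
  \<comment> \<open>\<open>r\<close> is the remainder after N Taylor terms, described by its
    coefficients and by its effect on \<open>L\<close>.\<close>
  let ?P = "\<lambda>N r. r \<in> bergman_space \<alpha> \<and> (\<forall>j. taylor_coeff r j = (if j < N then 0 else taylor_coeff h j))
      \<and> L h = (\<Sum>j<N. taylor_coeff h j * L (bergman_monom j)) + L r"
  have "\<exists>r. ?P N r" for N
  proof (induction N)
    case 0
    show ?case using h by auto
  next
    case (Suc N)
    then obtain r where r: "?P N r" by blast
    \<comment> \<open>The factor 1 gives the combination the shape required by \<open>lin\<close>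
      and \<open>bergman_space_linear\<close>.\<close>
    define r' where "r' = (\<lambda>z. 1 * r z + (- taylor_coeff h N) * bergman_monom N z)"
    have "r' \<in> bergman_space \<alpha>"
      unfolding r'_def using r by (intro bergman_space_linear bergman_monom_in_space) auto
    moreover have "taylor_coeff r' j = (if j < Suc N then 0 else taylor_coeff h j)" for j
      unfolding r'_def
      by (subst taylor_coeff_linear)
        (use r bergman_spaceD(1) bergman_monom_in_space in \<open>auto simp: taylor_coeff_monom less_Suc_eq\<close>)
    moreover have "L r' = L r - taylor_coeff h N * L (bergman_monom N)"
      unfolding r'_def by (subst lin) (use r bergman_monom_in_space in auto)
    ultimately have "?P (Suc N) r'" using r by simp
    then show ?case by blast
  qed
  then obtain r where r: "\<And>N. ?P N (r N)" by metis
  have norm_r: "bergman_norm \<alpha> (r N) = sqrt (suminf ?x - sum ?x {..<N})" for N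
  proof -
    have "(\<lambda>j. (cmod (taylor_coeff (r N) j))\<^sup>2 * bergman_weight \<alpha> j) = (\<lambda>j. if j < N then 0 else ?x j)"
      using r[of N] by auto
    moreover have "(\<lambda>j. if j < N then 0 else ?x j) sums (suminf ?x - sum ?x {..<N})"
    proof -
      have "(\<lambda>i. ?x (i + N)) sums (suminf ?x - sum ?x {..<N})"
        using bergman_spaceD(3)[OF h] summable_sums sums_iff_shift[of ?x N] by auto
      then have "(\<lambda>i. if i + N < N then 0 else ?x (i + N)) sums (suminf ?x - sum ?x {..<N})"
        by simp
      then show ?thesis
        by (subst (asm) sums_zero_iff_shift[of N "\<lambda>j. if j < N then 0 else ?x j"]) auto
    qed
    ultimately show ?thesis by (simp add: bergman_norm_def sums_iff)
  qed
  have "(\<lambda>N. suminf ?x - sum ?x {..<N}) \<longlonglongrightarrow> suminf ?x - suminf ?x"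
    by (intro tendsto_diff tendsto_const summable_LIMSEQ bergman_spaceD(3)[OF h])
  then have "(\<lambda>N. M * sqrt (suminf ?x - sum ?x {..<N})) \<longlonglongrightarrow> M * sqrt (suminf ?x - suminf ?x)"
    by (intro tendsto_mult tendsto_real_sqrt tendsto_const)
  then have "(\<lambda>N. M * bergman_norm \<alpha> (r N)) \<longlonglongrightarrow> 0"
    by (simp add: norm_r)
  then have "(\<lambda>N. L (r N)) \<longlonglongrightarrow> 0"
    by (rule Lim_null_comparison[rotated]) (use bdd r in auto)
  then have "(\<lambda>N. L h - L (r N)) \<longlonglongrightarrow> L h - 0"
    by (intro tendsto_intros)
  moreover have "L h - L (r N) = (\<Sum>j<N. taylor_coeff h j * L (bergman_monom j))" for N
    using r[of N] by (simp add: algebra_simps)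
  ultimately show ?thesis by (simp add: sums_def)
qed

section \<open>Reproducing kernels in closed form\<close>

text \<open>The explicit candidate for \<open>bergman_kernel\<close>, with which it is identified in
  \<open>bergman_kernel_eq\<close>. The Pochhammer symbol is the product
  (\<alpha>+2)...(\<alpha>+m+1).\<close>

definition bergman_kernel_fun :: "nat \<Rightarrow> complex \<Rightarrow> complex \<Rightarrow> complex" where
  "bergman_kernel_fun m w z = (if z \<in> unit_disc then
     pochhammer (of_real (\<alpha> + 2)) m * z ^ m * (1 - cnj w * z) powr (- of_real (real m + \<alpha> + 2))
   else 0)"

text \<open>This is the binomial series with exponent -(\<alpha>+2+m), shifted by m places; the two
  rising factorials join into a single one of length j.\<close>

lemma bergman_kernel_fun_sums:
  assumes "w \<in> unit_disc" "z \<in> unit_disc"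
  shows "(\<lambda>j. (if j < m then 0 else pochhammer (of_real (\<alpha> + 2)) j / fact (j - m) * cnj w ^ (j - m)) * z ^ j)
    sums bergman_kernel_fun m w z"
    (is "?f sums _")
proof -
  let ?q = "of_real (\<alpha> + 2) :: complex"
  have "cmod (cnj w * z) < 1"
    using assms norm_mult_less[of "cnj w" 1 z 1] by simp
  from sums_mult[OF one_minus_powr_sums[OF this, of "?q + of_nat m"], of "pochhammer ?q m * z ^ m"]
  have "(\<lambda>i. pochhammer ?q m * z ^ m * (pochhammer (?q + of_nat m) i / fact i * (cnj w * z) ^ i))
      sums bergman_kernel_fun m w z"
    using assms(2) by (simp add: bergman_kernel_fun_def add_ac)
  moreover have "pochhammer ?q m * z ^ m * (pochhammer (?q + of_nat m) i / fact i * (cnj w * z) ^ i)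
      = ?f (i + m)" for i
    using pochhammer_product'[of ?q m i]
    by (simp add: power_add power_mult_distrib add.commute mult_ac)
  ultimately have "(\<lambda>i. ?f (i + m)) sums bergman_kernel_fun m w z"
    by simp
  then show ?thesis
    by (subst (asm) sums_zero_iff_shift) auto
qed

lemma bergman_kernel_fun_holomorphic:
  "w \<in> unit_disc \<Longrightarrow> bergman_kernel_fun m w holomorphic_on unit_disc"
  by (rule holomorphic_on_disc_powser[OF bergman_kernel_fun_sums])

lemma taylor_coeff_kernel_fun:
  "w \<in> unit_disc \<Longrightarrow> taylor_coeff (bergman_kernel_fun m w) j
     = (if j < m then 0 else pochhammer (of_real (\<alpha> + 2)) j / fact (j - m) * cnj w ^ (j - m))"
  by (rule taylor_coeff_unique[OF bergman_kernel_fun_sums])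

text \<open>The weight cancels the rising factorial in the kernel coefficient, leaving the Taylor
  series of the m-th derivative of \<open>f\<close>, shifted by m. Holomorphy is the hypothesis on
  \<open>f\<close> because the lemma is also applied to the kernel itself, before its membership in
  the space is known.\<close>

lemma bergman_kernel_fun_reproducing_sums:
  assumes f: "f holomorphic_on unit_disc" and w: "w \<in> unit_disc"
  shows "(\<lambda>j. taylor_coeff f j * cnj (taylor_coeff (bergman_kernel_fun m w) j) * of_real (bergman_weight \<alpha> j))
    sums (deriv ^^ m) f w"
    (is "?f sums _")
proof -
  have "(\<lambda>i. taylor_coeff ((deriv ^^ m) f) i * w ^ i) sums (deriv ^^ m) f w"
    by (rule taylor_coeff_sums[OF holomorphic_higher_deriv[OF f] w]) auto
  moreover have "taylor_coeff ((deriv ^^ m) f) i * w ^ i = ?f (i + m)" for i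
  proof -
    let ?p = "pochhammer (\<alpha> + 2) (i + m)"
    have "taylor_coeff (bergman_kernel_fun m w) (i + m) = of_real ?p / fact i * cnj w ^ i"
      using w by (simp add: taylor_coeff_kernel_fun pochhammer_of_real del: of_real_add)
    then have "?f (i + m) = (deriv ^^ (i + m)) f 0 / fact (i + m) * (of_real ?p / fact i * w ^ i)
        * (fact (i + m) / of_real ?p)"
      by (simp add: taylor_coeff_def bergman_weight_pochhammer)
    also have "\<dots> = (deriv ^^ (i + m)) f 0 / fact i * w ^ i"
      using pochhammer_alpha_pos[of "i + m"] by simp
    finally show ?thesis
      by (simp add: taylor_coeff_def funpow_add)
  qed
  ultimately have "(\<lambda>i. ?f (i + m)) sums (deriv ^^ m) f w"
    by simp
  then show ?thesis
    by (subst (asm) sums_zero_iff_shift) (use w in \<open>auto simp: taylor_coeff_kernel_fun\<close>)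
qed

text \<open>With \<open>f\<close> taken to be the kernel itself, the reproducing series is the
  series of the squared norm, so it converges.\<close>

lemma bergman_kernel_fun_in_space:
  assumes w: "w \<in> unit_disc"
  shows "bergman_kernel_fun m w \<in> bergman_space \<alpha>"
proof -
  let ?k = "bergman_kernel_fun m w"
  have "summable (\<lambda>j. taylor_coeff ?k j * cnj (taylor_coeff ?k j) * of_real (bergman_weight \<alpha> j))"
    using bergman_kernel_fun_reproducing_sums[OF bergman_kernel_fun_holomorphic[OF w] w]
    by (rule sums_summable)
  then have "summable (\<lambda>j. complex_of_real ((cmod (taylor_coeff ?k j))\<^sup>2 * bergman_weight \<alpha> j))"
    by (simp only: complex_norm_square[symmetric] of_real_mult)
  then have "summable (\<lambda>j. (cmod (taylor_coeff ?k j))\<^sup>2 * bergman_weight \<alpha> j)"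
    by (simp only: summable_complex_of_real)
  then show ?thesis
    using bergman_kernel_fun_holomorphic[OF w]
    by (simp add: bergman_space_def) (simp add: bergman_kernel_fun_def)
qed

lemma bergman_inner_kernel_fun:
  assumes "f \<in> bergman_space \<alpha>" "w \<in> unit_disc"
  shows "bergman_inner \<alpha> f (bergman_kernel_fun m w) = (deriv ^^ m) f w"
  using bergman_kernel_fun_reproducing_sums[OF bergman_spaceD(1)[OF assms(1)] assms(2)]
  by (simp add: bergman_inner_def sums_iff)

lemma bergman_kernel_eq:
  assumes "w \<in> unit_disc"
  shows "bergman_kernel \<alpha> m w = bergman_kernel_fun m w"
  unfolding bergman_kernel_def
proof (rule the_equality)
  show "bergman_kernel_fun m w \<in> bergman_space \<alpha> \<and>
      (\<forall>f\<in>bergman_space \<alpha>. bergman_inner \<alpha> f (bergman_kernel_fun m w) = (deriv ^^ m) f w)"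
    using assms bergman_kernel_fun_in_space bergman_inner_kernel_fun by blast
next
  fix k assume k: "k \<in> bergman_space \<alpha> \<and>
      (\<forall>f\<in>bergman_space \<alpha>. bergman_inner \<alpha> f k = (deriv ^^ m) f w)"
  show "k = bergman_kernel_fun m w"
  proof (rule bergman_inner_ext)
    fix f assume "f \<in> bergman_space \<alpha>"
    then show "bergman_inner \<alpha> f k = bergman_inner \<alpha> f (bergman_kernel_fun m w)"
      using k assms bergman_inner_kernel_fun by simp
  qed (use k assms bergman_kernel_fun_in_space in auto)
qed

lemma J_conj_kernel_fun:
  assumes "w \<in> unit_disc"
  shows "J_conj (bergman_kernel_fun m w) = bergman_kernel_fun m (cnj w)"
proof
  fix z
  show "J_conj (bergman_kernel_fun m w) z = bergman_kernel_fun m (cnj w) z"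
  proof (cases "z \<in> unit_disc")
    case True
    then have "cnj z \<in> unit_disc" "cnj w \<in> unit_disc" using assms by auto
    from one_minus_mult_in_right_half_plane(1)[OF this(2,1)]
    \<comment> \<open>The exponent is real and the base lies off the branch cut, so conjugation
      passes through the power.\<close>
    have "cnj ((1 - cnj w * cnj z) powr (- of_real (real m + \<alpha> + 2)))
        = (1 - w * z) powr (- of_real (real m + \<alpha> + 2))"
      by (subst cnj_powr) (auto simp del: of_real_add)
    moreover have "cnj (pochhammer (of_real (\<alpha> + 2)) m) = pochhammer (of_real (\<alpha> + 2)) m"
      by (simp add: pochhammer_of_real del: of_real_add)
    ultimately show ?thesis
      using True by (simp add: J_conj_def bergman_kernel_fun_def del: of_real_add)
  qed (simp add: J_conj_def bergman_kernel_fun_def)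
qed

text \<open>Conjugate symmetry of the inner product of two kernels computes the derivatives of a kernel
  without differentiating powers.\<close>

lemma higher_deriv_kernel_fun:
  assumes "u \<in> unit_disc" "w \<in> unit_disc"
  shows "(deriv ^^ m) (bergman_kernel_fun 0 (cnj w)) u = bergman_kernel_fun m (cnj u) w"
proof -
  have cw: "cnj w \<in> unit_disc" using assms by simp
  have "(deriv ^^ m) (bergman_kernel_fun 0 (cnj w)) u
      = bergman_inner \<alpha> (bergman_kernel_fun 0 (cnj w)) (bergman_kernel_fun m u)"
    using assms cw by (simp add: bergman_inner_kernel_fun bergman_kernel_fun_in_space)
  also have "\<dots> = cnj (bergman_inner \<alpha> (bergman_kernel_fun m u) (bergman_kernel_fun 0 (cnj w)))"
    using assms cw by (intro bergman_inner_cnj bergman_kernel_fun_in_space) auto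
  also have "\<dots> = J_conj (bergman_kernel_fun m u) w"
    using assms cw by (simp add: bergman_inner_kernel_fun bergman_kernel_fun_in_space J_conj_def)
  finally show ?thesis using assms by (simp add: J_conj_kernel_fun)
qed

section \<open>Symmetry of the operator as an identity between kernels\<close>

text \<open>Neither direction needs the Riesz representation theorem: the adjoint is computed explicitly
  on kernels, and conversely \<open>J T J\<close> is checked to be an adjoint by extending the kernel identity
  to monomials, and hence to the whole space, by continuity.\<close>

lemma C_symmetric_comp_diff_op_iff:
  assumes phi: "\<phi> ` unit_disc \<subseteq> unit_disc" and bdd: "bounded_operator \<alpha> (comp_diff_op \<psi> \<phi> n)"
  shows "C_symmetric \<alpha> J_conj (comp_diff_op \<psi> \<phi> n) \<longleftrightarrow>
    (\<forall>z\<in>unit_disc. \<forall>w\<in>unit_disc.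
       \<psi> z * bergman_kernel_fun n (cnj (\<phi> z)) w = \<psi> w * bergman_kernel_fun n (cnj (\<phi> w)) z)"
    (is "?sym \<longleftrightarrow> ?ker")
proof
  let ?T = "comp_diff_op \<psi> \<phi> n" and ?k = bergman_kernel_fun
  note phiD = subsetD[OF phi, OF imageI]
  have T_space: "?T f \<in> bergman_space \<alpha>" if "f \<in> bergman_space \<alpha>" for f
    using bdd that by (auto simp: bounded_operator_def)
  have T_kernel: "?T (?k 0 (cnj w)) z = \<psi> z * ?k n (cnj (\<phi> z)) w"
    if "z \<in> unit_disc" "w \<in> unit_disc" for z w
    using that phiD[of z] by (simp add: comp_diff_op_def higher_deriv_kernel_fun)
  \<comment> \<open>Pairing with the kernel at w evaluates \<open>?T f\<close> there, giving
    \<psi>(w) times the n-th derivative of f at \<phi>(w). That derivative is again a pairing, with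
    the kernel of order n at \<phi>(w).\<close>
  have inner_T_kernel: "bergman_inner \<alpha> (?T f) (?k 0 w) = bergman_inner \<alpha> f (\<lambda>z. cnj (\<psi> w) * ?k n (\<phi> w) z)"
    if "f \<in> bergman_space \<alpha>" "w \<in> unit_disc" for f w
    using that phiD[of w] T_space[OF that(1)]
    by (simp add: bergman_inner_kernel_fun bergman_kernel_fun_in_space bergman_inner_scale_right)
      (simp add: comp_diff_op_def)
  show ?ker if ?sym
  proof (intro ballI)
    fix z w :: complex assume zw: "z \<in> unit_disc" "w \<in> unit_disc"
    then have cw: "cnj w \<in> unit_disc" by simp
    have adj: "bergman_adjoint \<alpha> ?T (?k 0 w) = (\<lambda>z. cnj (\<psi> w) * ?k n (\<phi> w) z)"
      using zw phiD[of w]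
      by (intro bergman_adjoint_eqI bergman_space_scale bergman_kernel_fun_in_space inner_T_kernel) auto
    have "?T (?k 0 (cnj w)) = J_conj (bergman_adjoint \<alpha> ?T (J_conj (?k 0 (cnj w))))"
      using \<open>?sym\<close> bergman_kernel_fun_in_space[OF cw] by (simp add: C_symmetric_def)
    also have "\<dots> = (\<lambda>z. \<psi> w * ?k n (cnj (\<phi> w)) z)"
      using cw phiD[OF zw(2)] by (simp add: J_conj_kernel_fun adj J_conj_scale)
    finally show "\<psi> z * ?k n (cnj (\<phi> z)) w = \<psi> w * ?k n (cnj (\<phi> w)) z"
      using T_kernel[OF zw] by simp
  qed
  show ?sym if ker: ?ker
  proof -
    obtain M where M: "\<And>f. f \<in> bergman_space \<alpha> \<Longrightarrow> bergman_norm \<alpha> (?T f) \<le> M * bergman_norm \<alpha> f"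
      using bdd unfolding bounded_operator_def by blast
    have T_lin: "?T (\<lambda>z. u * f z + v * g z) = (\<lambda>z. u * ?T f z + v * ?T g z)"
      if "f \<in> bergman_space \<alpha>" "g \<in> bergman_space \<alpha>" for f g u v
      using bdd that unfolding bounded_operator_def by blast
    have T_kernel_eq: "?T (?k 0 (cnj w)) = (\<lambda>z. \<psi> w * ?k n (cnj (\<phi> w)) z)"
      if w: "w \<in> unit_disc" for w
    proof
      fix z show "?T (?k 0 (cnj w)) z = \<psi> w * ?k n (cnj (\<phi> w)) z"
      proof (cases "z \<in> unit_disc")
        case True
        then show ?thesis using T_kernel[OF True w] ker w by simp
      qed (simp add: comp_diff_op_def bergman_kernel_fun_def)
    qed
    have key: "bergman_inner \<alpha> (?T f) (J_conj h) = bergman_inner \<alpha> f (J_conj (?T h))"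
      if f: "f \<in> bergman_space \<alpha>" and h: "h \<in> bergman_space \<alpha>" for f h
    proof -
      \<comment> \<open>The defect of the adjoint relation, as a functional of \<open>h\<close>. It
        is linear because \<open>J_conj\<close> and the second slot of the inner product are both
        antilinear.\<close>
      define L where "L h = bergman_inner \<alpha> (?T f) (J_conj h) - bergman_inner \<alpha> f (J_conj (?T h))" for h
      define B where "B = bergman_norm \<alpha> (?T f) + bergman_norm \<alpha> f * M"
      have lin: "L (\<lambda>z. u * f1 z + v * f2 z) = u * L f1 + v * L f2"
        if "f1 \<in> bergman_space \<alpha>" "f2 \<in> bergman_space \<alpha>" for f1 f2 u v
        using that f
        by (simp add: L_def T_lin J_conj_linear bergman_inner_linear_right T_space
            J_conj_in_bergman_space algebra_simps)
      have bound: "cmod (L h) \<le> B * bergman_norm \<alpha> h" if "h \<in> bergman_space \<alpha>" for h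
      proof -
        have "cmod (L h) \<le> cmod (bergman_inner \<alpha> (?T f) (J_conj h)) + cmod (bergman_inner \<alpha> f (J_conj (?T h)))"
          unfolding L_def by (rule norm_triangle_ineq4)
        also have "\<dots> \<le> bergman_norm \<alpha> (?T f) * bergman_norm \<alpha> h + bergman_norm \<alpha> f * bergman_norm \<alpha> (?T h)"
          using bergman_Cauchy_Schwarz[OF T_space[OF f] J_conj_in_bergman_space[OF that]]
            bergman_Cauchy_Schwarz[OF f J_conj_in_bergman_space[OF T_space[OF that]]]
          by (simp add: bergman_norm_J_conj that T_space)
        also have "\<dots> \<le> bergman_norm \<alpha> (?T f) * bergman_norm \<alpha> h + bergman_norm \<alpha> f * (M * bergman_norm \<alpha> h)"
          by (intro add_left_mono mult_left_mono M that bergman_norm_nonneg f)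
        finally show ?thesis by (simp add: B_def algebra_simps)
      qed
      have L_sums: "(\<lambda>j. taylor_coeff f j * L (bergman_monom j)) sums L f"
        if "f \<in> bergman_space \<alpha>" for f
        by (rule bounded_functional_sums[of L B, OF lin bound that])
      have L_kernel: "L (?k 0 (cnj w)) = 0" if w: "w \<in> unit_disc" for w
        using w phiD[OF w] f
        by (simp add: L_def T_kernel_eq J_conj_scale J_conj_kernel_fun inner_T_kernel)
      have L_monom: "L (bergman_monom j) = 0" for j
      proof -
        let ?q = "of_real (\<alpha> + 2) :: complex"
        \<comment> \<open>Expanding the kernel into monomials turns the vanishing of
          \<open>L\<close> on kernels into a power series in w with sum 0. Its coefficients are
          nonzero multiples of the values of \<open>L\<close> on monomials.\<close>
        have sums0: "(\<lambda>j. (pochhammer ?q j / fact j * L (bergman_monom j)) * w ^ j) sums 0"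
          if w: "w \<in> unit_disc" for w
        proof -
          have cw: "cnj w \<in> unit_disc" using w by simp
          show ?thesis
            using L_sums[OF bergman_kernel_fun_in_space[OF cw, of 0]] L_kernel[OF w]
            by (simp add: taylor_coeff_kernel_fun[OF cw] mult_ac)
        qed
        have "taylor_coeff (\<lambda>_. 0) j = pochhammer ?q j / fact j * L (bergman_monom j)"
          by (rule taylor_coeff_unique) (rule sums0)
        moreover have "taylor_coeff (\<lambda>_. 0) j = 0"
          by (rule taylor_coeff_unique) simp
        ultimately show ?thesis using pochhammer_alpha_nonzero[of j] by simp
      qed
      have "L h = 0"
        using L_sums[OF h] L_monom by (simp add: sums_iff)
      then show ?thesis by (simp add: L_def)
    qed
    have "J_conj (bergman_adjoint \<alpha> ?T (J_conj f)) = ?T f" if f: "f \<in> bergman_space \<alpha>" for f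
    proof -
      have "bergman_adjoint \<alpha> ?T (J_conj f) = J_conj (?T f)"
        using f key by (intro bergman_adjoint_eqI J_conj_in_bergman_space T_space)
      then show ?thesis by simp
    qed
    then show ?sym
      using conjugation_J_conj bdd by (simp add: C_symmetric_def)
  qed
qed

end

section \<open>Solving the kernel identity\<close>

text \<open>Both arguments are below pi/2 in absolute value, so their sum stays in the range of the
  principal logarithm.\<close>

lemma powr_times_right_half_plane:
  fixes x y s :: complex
  assumes "Re x > 0" "Re y > 0"
  shows "(x * y) powr s = x powr s * y powr s"
proof -
  have "x \<noteq> 0" "y \<noteq> 0"
    using assms by auto
  moreover from this have "\<bar>Im (Ln x)\<bar> < pi / 2" "\<bar>Im (Ln y)\<bar> < pi / 2"
    using assms Re_Ln_pos_lt[of x] Re_Ln_pos_lt[of y] by auto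
  ultimately have "Ln (x * y) = Ln x + Ln y"
    by (intro Ln_times_simple) linarith+
  then show ?thesis
    using \<open>x \<noteq> 0\<close> \<open>y \<noteq> 0\<close> by (simp add: powr_def distrib_left exp_add)
qed

text \<open>Both bases lie in the right half-plane, so the two powers merge into the power of (1 - c
  x)(1 - c y) - b x y, which is unchanged when x and y are swapped.\<close>

lemma kernel_identity_if_form:
  fixes \<phi> :: "complex \<Rightarrow> complex"
  assumes phi: "\<phi> ` unit_disc \<subseteq> unit_disc" and c: "c \<in> unit_disc"
    and form: "\<And>z. z \<in> unit_disc \<Longrightarrow> \<phi> z = c + b * z / (1 - c * z)"
    and zw: "z \<in> unit_disc" "w \<in> unit_disc"
  shows "(1 - c * z) powr s * (1 - \<phi> z * w) powr s = (1 - c * w) powr s * (1 - \<phi> w * z) powr s"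
proof -
  note phiD = subsetD[OF phi, OF imageI]
  have prod: "(1 - c * x) * (1 - \<phi> x * y) = (1 - c * x) * (1 - c * y) - b * x * y"
    if "x \<in> unit_disc" for x y
    using one_minus_mult_in_right_half_plane(3)[OF c that]
    by (simp add: form[OF that] field_simps)
  have "(1 - c * x) powr s * (1 - \<phi> x * y) powr s = ((1 - c * x) * (1 - \<phi> x * y)) powr s"
    if "x \<in> unit_disc" "y \<in> unit_disc" for x y
    using that c phiD[of x]
    by (intro powr_times_right_half_plane[symmetric] one_minus_mult_in_right_half_plane(1))
  then have "(1 - c * x) powr s * (1 - \<phi> x * y) powr s = ((1 - c * x) * (1 - c * y) - b * x * y) powr s"
    if "x \<in> unit_disc" "y \<in> unit_disc" for x y
    using that by (simp only: prod)
  from this[OF zw] this[OF zw(2,1)] show ?thesis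
    by (simp add: mult_ac)
qed

lemma form_if_kernel_identity:
  fixes \<psi> \<phi> :: "complex \<Rightarrow> complex" and p :: complex
  assumes n: "n > 0" and p: "p \<noteq> 0"
    and psi_nz: "\<exists>z\<in>unit_disc. \<psi> z \<noteq> 0"
    and phi_hol: "\<phi> holomorphic_on unit_disc" and phi: "\<phi> ` unit_disc \<subseteq> unit_disc"
    and eq: "\<And>z w. z \<in> unit_disc \<Longrightarrow> w \<in> unit_disc \<Longrightarrow>
      \<psi> z * (w ^ n * (1 - \<phi> z * w) powr (- p)) = \<psi> w * (z ^ n * (1 - \<phi> w * z) powr (- p))"
  shows "(deriv ^^ n) \<psi> 0 \<noteq> 0"
    and "z \<in> unit_disc \<Longrightarrow> \<psi> z = (deriv ^^ n) \<psi> 0 * z ^ n / (fact n * (1 - \<phi> 0 * z) powr p)"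
    and "z \<in> unit_disc \<Longrightarrow> \<phi> z = \<phi> 0 + deriv \<phi> 0 * z / (1 - \<phi> 0 * z)"
proof -
  note phiD = subsetD[OF phi, OF imageI]
  define E where "E x = (1 - x) powr (- p)" for x :: complex
  have E0 [simp]: "E 0 = 1" by (simp add: E_def)
  have E_nz: "E (\<phi> z * w) \<noteq> 0" if "z \<in> unit_disc" "w \<in> unit_disc" for z w
    using one_minus_mult_in_right_half_plane(3)[OF phiD[OF that(1)] that(2)] by (simp add: E_def)
  have E_deriv: "((\<lambda>x. E (f x)) has_field_derivative (p * E (f x) / (1 - f x) * f')) (at x)"
    if "(f has_field_derivative f') (at x)" "1 - f x \<notin> \<real>\<^sub>\<le>\<^sub>0" for f f' x
  proof -
    have "1 - f x \<noteq> 0" using that(2) by auto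
    then have "(1 - f x) powr (- p - 1) = E (f x) / (1 - f x)"
      unfolding E_def by (subst powr_diff) auto
    then show ?thesis
      unfolding E_def using that by (auto intro!: derivative_eq_intros simp: E_def)
  qed
  have E_hol1: "(\<lambda>z. E (\<phi> z * w)) holomorphic_on unit_disc" if "w \<in> unit_disc" for w
    unfolding E_def using one_minus_mult_in_right_half_plane(2) phiD that
    by (intro holomorphic_intros phi_hol) auto
  have E_hol2: "(\<lambda>w. E (\<phi> z * w)) holomorphic_on unit_disc" if "z \<in> unit_disc" for z
    unfolding E_def using one_minus_mult_in_right_half_plane(2) phiD that
    by (intro holomorphic_intros) auto
  have zero: "(0::complex) \<in> unit_disc" by simp
  \<comment> \<open>At z = 0 the right side of \<open>eq\<close> contains 0^n, which vanishes since
    n > 0. Hence a point where \<psi> is nonzero is itself nonzero.\<close>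
  have "\<psi> 0 = 0"
    using eq[of 0 "1/2"] E_nz[of 0 "1/2"] n by (simp add: E_def power_0_left)
  then obtain v where v: "v \<in> unit_disc" "\<psi> v \<noteq> 0" "v \<noteq> 0"
    using psi_nz by metis
  \<comment> \<open>The identity at w = v, solved for \<psi>(z) / z^n. The quotient is holomorphic
    at 0 by its formula, as \<open>E\<close> has no zeros at the relevant points.\<close>
  define g where "g z = \<psi> v / v ^ n * E (\<phi> v * z) / E (\<phi> z * v)" for z
  have g_hol: "g holomorphic_on unit_disc"
    unfolding g_def using v E_nz by (intro holomorphic_intros E_hol1 E_hol2) auto
  have psi_g: "\<psi> z = z ^ n * g z" if "z \<in> unit_disc" for z
    using eq[OF that v(1)] E_nz[OF that v(1)] v(3)
    by (simp add: g_def E_def field_simps)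
  have g_eq: "g z * E (\<phi> z * w) = g w * E (\<phi> w * z)"
    if "z \<in> unit_disc" "w \<in> unit_disc" "z \<noteq> 0" "w \<noteq> 0" for z w
    using eq[OF that(1,2)] that by (simp add: psi_g E_def mult_ac)
  have g_form: "g z = g 0 * E (\<phi> 0 * z)" if z: "z \<in> unit_disc" for z
  proof (cases "z = 0")
    case False
    \<comment> \<open>The divided identity \<open>g_eq\<close> is known only off the axes;
      continuity carries it to w = 0.\<close>
    have "(\<lambda>w. g z * E (\<phi> z * w) - g w * E (\<phi> w * z)) holomorphic_on unit_disc"
      using z by (intro holomorphic_intros g_hol E_hol1 E_hol2)
    then have "isCont (\<lambda>w. g z * E (\<phi> z * w) - g w * E (\<phi> w * z)) 0"
      using holomorphic_on_imp_continuous_on continuous_on_interior[of unit_disc _ 0] by fastforce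
    then have "((\<lambda>w. g z * E (\<phi> z * w) - g w * E (\<phi> w * z)) \<longlongrightarrow> g z * E (\<phi> z * 0) - g 0 * E (\<phi> 0 * z)) (at 0)"
      by (simp only: isCont_def)
    moreover have "eventually (\<lambda>w. g z * E (\<phi> z * w) - g w * E (\<phi> w * z) = 0) (at 0)"
    proof -
      have "eventually (\<lambda>w. w \<in> unit_disc - {0}) (at (0::complex))"
        by (intro eventually_at_in_open) auto
      then show ?thesis
        by eventually_elim (use g_eq[OF z] False in auto)
    qed
    then have "((\<lambda>w. g z * E (\<phi> z * w) - g w * E (\<phi> w * z)) \<longlongrightarrow> 0) (at 0)"
      by (rule tendsto_eventually)
    ultimately have "g z * E (\<phi> z * 0) - g 0 * E (\<phi> 0 * z) = 0"
      using LIM_unique by blast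
    then show ?thesis by simp
  qed simp
  have "g v \<noteq> 0" using psi_g[OF v(1)] v(2) by auto
  then have g0: "g 0 \<noteq> 0" using g_form[OF v(1)] by auto
  \<comment> \<open>The factor z^n shifts coefficients, so the n-th derivative of \<psi> at 0 is n!
    g(0).\<close>
  have "taylor_coeff \<psi> n = taylor_coeff g 0"
    using taylor_coeff_power_mult[OF g_hol psi_g] by simp
  then have a: "(deriv ^^ n) \<psi> 0 = fact n * g 0"
    by (simp add: taylor_coeff_def field_simps)
  show "(deriv ^^ n) \<psi> 0 \<noteq> 0"
    using a g0 by simp
  show "\<psi> z = (deriv ^^ n) \<psi> 0 * z ^ n / (fact n * (1 - \<phi> 0 * z) powr p)" if "z \<in> unit_disc"
    using psi_g[OF that] g_form[OF that] by (simp add: a E_def powr_minus field_simps)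
  show "\<phi> z = \<phi> 0 + deriv \<phi> 0 * z / (1 - \<phi> 0 * z)" if z: "z \<in> unit_disc"
  proof -
    \<comment> \<open>Inserting \<open>g_form\<close> into \<open>g_eq\<close> leaves the common
      factor g(0), which cancels; on the axes both sides agree because E(0) = 1.\<close>
    have sym: "E (\<phi> 0 * z) * E (\<phi> z * w) = E (\<phi> 0 * w) * E (\<phi> w * z)" if w: "w \<in> unit_disc" for w
    proof (cases "z = 0 \<or> w = 0")
      case False
      then have "g 0 * (E (\<phi> 0 * z) * E (\<phi> z * w)) = g 0 * (E (\<phi> 0 * w) * E (\<phi> w * z))"
        using g_eq[OF z w] g_form[OF z] g_form[OF w] by simp
      then show ?thesis using g0 by simp
    qed (auto simp: mult.commute)
    have dphi: "(\<phi> has_field_derivative deriv \<phi> 0) (at 0)"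
      using holomorphic_derivI[OF phi_hol open_ball zero] .
    have cz: "1 - \<phi> 0 * z \<notin> \<real>\<^sub>\<le>\<^sub>0" "1 - \<phi> 0 * z \<noteq> 0"
      using one_minus_mult_in_right_half_plane[OF phiD[OF zero] z] by auto
    have lin: "((\<lambda>w. E (u * w)) has_field_derivative p * u) (at 0)" for u
      using E_deriv[of "\<lambda>w. u * w" u 0] by (auto intro!: derivative_eq_intros)
    \<comment> \<open>Both sides of \<open>sym\<close> are differentiated in w at 0. Only the left
      derivative contains \<phi>(z), and it does so linearly.\<close>
    have "((\<lambda>w. E (\<phi> 0 * z) * E (\<phi> z * w)) has_field_derivative E (\<phi> 0 * z) * (p * \<phi> z)) (at 0)"
      by (rule DERIV_cmult[OF lin])
    then have lhs: "((\<lambda>w. E (\<phi> 0 * w) * E (\<phi> w * z)) has_field_derivative E (\<phi> 0 * z) * (p * \<phi> z)) (at 0)"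
      by (rule has_field_derivative_transform_within_open[of _ _ _ unit_disc]) (use sym in auto)
    have "((\<lambda>w. E (\<phi> w * z)) has_field_derivative
        p * E (\<phi> 0 * z) / (1 - \<phi> 0 * z) * (deriv \<phi> 0 * z)) (at 0)"
      by (rule E_deriv[of "\<lambda>w. \<phi> w * z"]) (use cz in \<open>auto intro!: derivative_eq_intros dphi\<close>)
    from DERIV_mult[OF lin[of "\<phi> 0"] this] lhs
    have "E (\<phi> 0 * z) * (p * \<phi> z)
        = p * \<phi> 0 * E (\<phi> 0 * z) + p * E (\<phi> 0 * z) / (1 - \<phi> 0 * z) * (deriv \<phi> 0 * z)"
      using DERIV_unique by fastforce
    \<comment> \<open>The factor E(\<phi>(0) z) p is common to all terms and nonzero.\<close>
    then have "(E (\<phi> 0 * z) * p) * \<phi> z = (E (\<phi> 0 * z) * p) * (\<phi> 0 + deriv \<phi> 0 * z / (1 - \<phi> 0 * z))"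
      by (simp add: algebra_simps)
    then show ?thesis
      using p E_nz[OF zero z] by simp
  qed
qed

section \<open>From the kernel identity to the closed forms of \<psi> and \<phi>\<close>

theorem theorem2p7:
  fixes \<alpha> :: real and n :: nat and \<psi> \<phi> :: "complex \<Rightarrow> complex"
  defines "t \<equiv> (\<Prod>k=2..n + 1. \<alpha> + real k)"
    and "a \<equiv> (deriv ^^ n) \<psi> 0"
    and "b \<equiv> deriv \<phi> 0"
    and "c \<equiv> \<phi> 0"
  assumes "\<alpha> > -1"
    and "n > 0"
    and "\<psi> holomorphic_on unit_disc"
    and "\<exists>z\<in>unit_disc. \<psi> z \<noteq> 0"
    and "\<phi> holomorphic_on unit_disc"
    and "\<phi> ` unit_disc \<subseteq> unit_disc"
    and "\<not> \<phi> constant_on unit_disc"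
    and "bounded_operator \<alpha> (comp_diff_op \<psi> \<phi> n)"
  shows "C_symmetric \<alpha> J_conj (comp_diff_op \<psi> \<phi> n) \<longleftrightarrow>
    a \<noteq> 0 \<and> b \<noteq> 0 \<and> c \<in> unit_disc \<and>
    (\<forall>z\<in>unit_disc.
       \<psi> z = a / (of_real t * fact n) * bergman_kernel \<alpha> n (cnj c) z \<and>
       a / (of_real t * fact n) * bergman_kernel \<alpha> n (cnj c) z =
         a * z ^ n / (fact n * (1 - c * z) powr of_real (real n + \<alpha> + 2)) \<and>
       \<phi> z = c + b * z / (1 - c * z))"
proof -
  note \<alpha> = \<open>\<alpha> > -1\<close> and phi = \<open>\<phi> ` unit_disc \<subseteq> unit_disc\<close>
  define p where "p = complex_of_real (real n + \<alpha> + 2)"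
  have p: "p \<noteq> 0"
    using \<alpha> unfolding p_def of_real_eq_0_iff by simp
  have c: "c \<in> unit_disc"
    using subsetD[OF phi imageI[of 0]] by (simp add: c_def)
  have t: "complex_of_real t = pochhammer (of_real (\<alpha> + 2)) n"
  proof -
    \<comment> \<open>The shift k = i + 2 turns \<open>t\<close> into the rising factorial in the
      kernel.\<close>
    have "t = (\<Prod>i=0..<n. \<alpha> + real (i + 2))"
      unfolding t_def
      by (rule prod.reindex_bij_witness[of _ "\<lambda>i. i + 2" "\<lambda>k. k - 2"]) auto
    then have "t = pochhammer (\<alpha> + 2) n"
      by (simp add: pochhammer_prod add_ac)
    then show ?thesis by (simp only: pochhammer_of_real)
  qed
  then have t_nz: "complex_of_real t \<noteq> 0"
    using pochhammer_alpha_nonzero[OF \<alpha>] by simp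
  have kernel: "a / (of_real t * fact n) * bergman_kernel \<alpha> n (cnj c) z
      = a * z ^ n / (fact n * (1 - c * z) powr p)" if "z \<in> unit_disc" for z
    using that c t_nz
    by (simp add: bergman_kernel_eq[OF \<alpha>] bergman_kernel_fun_def[OF \<alpha>] p_def powr_minus
        field_simps flip: t del: of_real_add)
  \<comment> \<open>Both sides of the kernel identity carry the nonzero factor \<open>t\<close>,
    which cancels.\<close>
  have "C_symmetric \<alpha> J_conj (comp_diff_op \<psi> \<phi> n) \<longleftrightarrow>
    (\<forall>z\<in>unit_disc. \<forall>w\<in>unit_disc.
       \<psi> z * (w ^ n * (1 - \<phi> z * w) powr (- p)) = \<psi> w * (z ^ n * (1 - \<phi> w * z) powr (- p)))"
    using t_nz assms
    by (subst C_symmetric_comp_diff_op_iff[OF \<alpha>])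
      (auto simp: bergman_kernel_fun_def[OF \<alpha>] p_def mult.left_commute[of _ "complex_of_real t"] mult.assoc
        simp flip: t simp del: of_real_add)
  also have "\<dots> \<longleftrightarrow> a \<noteq> 0 \<and> b \<noteq> 0 \<and>
      (\<forall>z\<in>unit_disc. \<psi> z = a * z ^ n / (fact n * (1 - c * z) powr p) \<and> \<phi> z = c + b * z / (1 - c * z))"
    (is "?ker \<longleftrightarrow> ?form")
  proof
    assume ?ker
    then have eq: "\<psi> z * (w ^ n * (1 - \<phi> z * w) powr (- p)) = \<psi> w * (z ^ n * (1 - \<phi> w * z) powr (- p))"
      if "z \<in> unit_disc" "w \<in> unit_disc" for z w
      using that by blast
    note form = form_if_kernel_identity[OF \<open>n > 0\<close> p \<open>\<exists>z\<in>unit_disc. \<psi> z \<noteq> 0\<close>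
        \<open>\<phi> holomorphic_on unit_disc\<close> phi eq, folded a_def b_def c_def]
    \<comment> \<open>With b = 0 the formula for \<phi> would reduce to the constant c.\<close>
    have "b \<noteq> 0"
    proof
      assume "b = 0"
      then have "\<phi> constant_on unit_disc"
        using form(3) by (auto simp: constant_on_def)
      then show False using \<open>\<not> \<phi> constant_on unit_disc\<close> by simp
    qed
    then show ?form using form by blast
  next
    assume form: ?form
    show ?ker
    proof (intro ballI)
      fix z w :: complex assume zw: "z \<in> unit_disc" "w \<in> unit_disc"
      have psi: "\<psi> x = a / fact n * x ^ n * (1 - c * x) powr (- p)" if "x \<in> unit_disc" for x
        using form that by (simp add: powr_minus field_simps)
      have "(1 - c * z) powr (- p) * (1 - \<phi> z * w) powr (- p)
          = (1 - c * w) powr (- p) * (1 - \<phi> w * z) powr (- p)"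
        by (rule kernel_identity_if_form[OF phi c _ zw]) (use form in blast)
      then show "\<psi> z * (w ^ n * (1 - \<phi> z * w) powr (- p)) = \<psi> w * (z ^ n * (1 - \<phi> w * z) powr (- p))"
        using psi zw by (simp add: mult_ac)
    qed
  qed
  finally show ?thesis
    using kernel c unfolding p_def by auto
qed

end
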